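(* Let $n$ be a positive integer and let $\mathcal{F}\subseteq 2^{[n]}$ be a nonempty extremal family with $\dim_{VC}(\mathcal{F})\leq 2$. Then there exists an element $F\in\mathcal{F}$ such that $\mathcal{F}\setminus\{F\}$ is still extremal.
   Context: Notation: $[n]=\{1,\dots,n\}$; $2^S$ is the power set of $S$. A set system $\mathcal{F}\subseteq 2^{[n]}$ shatters $S\subseteq[n]$ if $\{F\cap S : F\in\mathcal{F}\}=2^S$. $Sh(\mathcal{F})$ is the family of all subsets of $[n]$ shattered by $\mathcal{F}$. $\mathcal{F}$ is extremal (shattering-extremal, s-extremal) if $|Sh(\mathcal{F})|=|\mathcal{F}|$ (so the empty family, which shatters no set, is extremal). The Vapnik-Chervonenkis dimension $\dim_{VC}(\mathcal{F})$ of a nonempty $\mathcal{F}$ is the maximum cardinality of a set shattered by $\mathcal{F}$. *)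

theory Defs
  imports Main
begin

definition shatters :: "'a set set \<Rightarrow> 'a set \<Rightarrow> bool" where
  "shatters \<F> S \<longleftrightarrow> {F \<inter> S | F. F \<in> \<F>} = Pow S"

definition Sh :: "nat \<Rightarrow> nat set set \<Rightarrow> nat set set" where
  "Sh n \<F> = {S. S \<subseteq> {1..n} \<and> shatters \<F> S}"

definition extremal :: "nat \<Rightarrow> nat set set \<Rightarrow> bool" where
  "extremal n \<F> \<longleftrightarrow> card (Sh n \<F>) = card \<F>"

text \<open>
  The maximum below is taken over a finite set, which is nonempty when the family is nonempty
  (the empty set is then shattered). For the empty family the value is unspecified.
\<close>

definition dim_VC :: "nat \<Rightarrow> nat set set \<Rightarrow> nat" where
  "dim_VC n \<F> = Max (card ` Sh n \<F>)"

end

(* An element u of an extremal family H is a corner if some shattered set S has u as the only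
   member with trace u \<inter> S; deleting u destroys S, so by Pajor's inequality extremality survives.
   To find corners one proves more: if H has dimension at most 2 and T is a proper extremal
   subfamily of dimension at most 1 (a tree), then H has a corner outside T. Splitting along a
   label y, each side of H is extremal, as is its boundary: the members whose neighbour across
   y also lies in H. That boundary has dimension at most 1. A corner of a side that is not on its
   boundary is a corner of H, because sections of extremal families are connected. If T misses
   a side, recurse there with the boundary as new tree. Otherwise every label of H is one of T;
   take y to be the label of a leaf v of T and recurse into the side of v, or, if that side is
   just {v}, into the opposite side with T - {v}. A side equal to its boundary is itself a tree,
   and its leaves are corners of H. *)

theory Submission
  imports Defs
begin

section \<open>Shattered sets, sides and boundaries\<close>

definition shset :: "'a set set \<Rightarrow> 'a set set" where
  "shset F = {S. shatters F S}"

text \<open>Shattered sets lie inside \<open>\<Union>F\<close>, so no ground set is carried along.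
  Finiteness of the union keeps both cardinalities meaningful.\<close>

definition ext :: "'a set set \<Rightarrow> bool" where
  "ext F \<longleftrightarrow> finite (\<Union>F) \<and> card (shset F) = card F"

definition side :: "'a \<Rightarrow> bool \<Rightarrow> 'a set set \<Rightarrow> 'a set set" where
  "side y b F = {G \<in> F. (y \<in> G) = b}"

definition flip :: "'a \<Rightarrow> 'a set \<Rightarrow> 'a set" where
  "flip y G = (if y \<in> G then G - {y} else insert y G)"

definition bd :: "'a \<Rightarrow> bool \<Rightarrow> 'a set set \<Rightarrow> 'a set set" where
  "bd y b F = {G \<in> side y b F. flip y G \<in> F}"

lemma shatters_iff: "shatters F S \<longleftrightarrow> (\<forall>A. A \<subseteq> S \<longrightarrow> (\<exists>G \<in> F. G \<inter> S = A))"
proof -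
  have "{G \<inter> S |G. G \<in> F} \<subseteq> Pow S" by auto
  then have "shatters F S \<longleftrightarrow> Pow S \<subseteq> {G \<inter> S |G. G \<in> F}" unfolding shatters_def by auto
  also have "\<dots> \<longleftrightarrow> (\<forall>A. A \<subseteq> S \<longrightarrow> (\<exists>G \<in> F. A = G \<inter> S))"
    by (simp add: subset_iff Bex_def conj_commute)
  finally show ?thesis by (simp add: eq_commute)
qed

lemma in_shset_iff: "S \<in> shset F \<longleftrightarrow> (\<forall>A. A \<subseteq> S \<longrightarrow> (\<exists>G \<in> F. G \<inter> S = A))"
  by (simp add: shset_def shatters_iff)

lemma shset_subset: "S \<in> shset F \<Longrightarrow> S \<subseteq> \<Union>F"
  unfolding in_shset_iff by blast

lemma finite_shset: "finite (\<Union>F) \<Longrightarrow> finite (shset F)"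
  by (rule finite_subset[of _ "Pow (\<Union>F)"]) (use shset_subset in auto)

lemma shset_mono:
  assumes "F \<subseteq> F'"
  shows "shset F \<subseteq> shset F'"
proof
  fix S assume "S \<in> shset F"
  then show "S \<in> shset F'" using subsetD[OF assms] unfolding in_shset_iff by meson
qed

lemma side_subset: "side y b F \<subseteq> F"
  by (auto simp: side_def)

lemma side_memD: "G \<in> side y b F \<Longrightarrow> G \<in> F"
  by (simp add: side_def)

lemma shset_side: "S \<in> shset (side y b F) \<Longrightarrow> S \<in> shset F"
  unfolding in_shset_iff by (meson side_memD)

lemma side_Un: "side y b F \<union> side y (\<not> b) F = F"
  by (auto simp: side_def)

lemma side_disjoint: "side y b F \<inter> side y (\<not> b) F = {}"
  by (auto simp: side_def)

lemma card_side: "finite F \<Longrightarrow> card (side y b F) + card (side y (\<not> b) F) = card F"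
  by (metis card_Un_disjoint finite_Un side_Un side_disjoint)

lemma finite_Union_subset: "finite (\<Union>F') \<Longrightarrow> F \<subseteq> F' \<Longrightarrow> finite (\<Union>F)"
  by (meson Union_mono finite_subset)

lemma notin_shset_side: "S \<in> shset (side y b F) \<Longrightarrow> y \<notin> S"
proof
  assume S: "S \<in> shset (side y b F)" and y: "y \<in> S"
  \<comment> \<open>The requested trace gives \<open>y\<close> the value that this side
    excludes.\<close>
  obtain G where "G \<in> side y b F" "G \<inter> S = (if b then S - {y} else S)"
    using S unfolding in_shset_iff by (metis Diff_subset subset_refl)
  then show False using y by (auto simp: side_def split: if_splits)
qed

lemma flip_simps [simp]: "flip y (flip y G) = G" "y \<in> flip y G \<longleftrightarrow> y \<notin> G"
  by (auto simp: flip_def)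

lemma flip_other: "z \<noteq> y \<Longrightarrow> z \<in> flip y G \<longleftrightarrow> z \<in> G"
  by (auto simp: flip_def)

lemma flip_Int: "y \<notin> S \<Longrightarrow> flip y G \<inter> S = G \<inter> S"
  by (auto simp: flip_def)

lemma flip_neq: "flip y G \<noteq> G"
  by (auto simp: flip_def)

text \<open>Whether \<open>y\<close> lies in the wanted trace decides which side supplies the
  member.\<close>

lemma shset_insert:
  assumes "S \<in> shset (side y True F)" "S \<in> shset (side y False F)"
  shows "insert y S \<in> shset F"
  unfolding in_shset_iff
proof (intro allI impI)
  fix A assume A: "A \<subseteq> insert y S"
  have y: "y \<notin> S" using notin_shset_side assms by metis
  have "S \<in> shset (side y (y \<in> A) F)" using assms by (cases "y \<in> A") auto
  moreover have "A - {y} \<subseteq> S" using A by blast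
  ultimately obtain G where G: "G \<in> side y (y \<in> A) F" "G \<inter> S = A - {y}"
    unfolding in_shset_iff by blast
  then have "G \<inter> insert y S = A" using A y by (auto simp: side_def)
  then show "\<exists>G\<in>F. G \<inter> insert y S = A" using G by (auto simp: side_def)
qed

text \<open>Flipping \<open>y\<close> moves a boundary member to the other side without changing its
  trace on \<open>S\<close>, so both sides shatter \<open>S\<close>.\<close>

lemma shset_bd_insert:
  assumes "S \<in> shset (bd y b F)"
  shows "insert y S \<in> shset F" "y \<notin> S"
proof -
  have "S \<in> shset (side y b F)"
    using assms shset_mono[of "bd y b F" "side y b F"] by (auto simp: bd_def)
  then show y: "y \<notin> S" by (rule notin_shset_side)
  have "S \<in> shset (side y c F)" for c
    unfolding in_shset_iff
  proof (intro allI impI)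
    fix A assume "A \<subseteq> S"
    then obtain G where "G \<in> bd y b F" "G \<inter> S = A" using assms unfolding in_shset_iff by blast
    then show "\<exists>G\<in>side y c F. G \<inter> S = A"
      by (intro bexI[of _ "if b = c then G else flip y G"])
         (auto simp: bd_def side_def flip_Int y)
  qed
  then show "insert y S \<in> shset F" by (blast intro: shset_insert)
qed

section \<open>Pajor's inequality\<close>

lemma card_shset_sides:
  assumes "finite (\<Union>F)"
  shows "card (shset (side y b F)) + card (shset (side y (\<not> b) F)) \<le> card (shset F)"
proof -
  let ?A = "shset (side y b F)" and ?B = "shset (side y (\<not> b) F)"
  have fin: "finite ?A" "finite ?B"
    by (auto intro!: finite_shset finite_Union_subset[OF assms] simp: side_def)
  have ny: "\<And>S. S \<in> ?A \<union> ?B \<Longrightarrow> y \<notin> S" by (auto dest: notin_shset_side)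
  have inj: "inj_on (insert y) (?A \<inter> ?B)"
    by (rule inj_onI) (metis Un_iff Int_iff insert_ident ny)
  \<comment> \<open>A set shattered by both sides counts twice on the left; its second copy is
    represented by adding \<open>y\<close>.\<close>
  have "card ?A + card ?B = card (?A \<union> ?B) + card (insert y ` (?A \<inter> ?B))"
    using card_Un_Int[OF fin] by (simp add: card_image inj)
  also have "\<dots> = card ((?A \<union> ?B) \<union> insert y ` (?A \<inter> ?B))"
    by (rule card_Un_disjoint[symmetric]) (use fin ny in auto)
  also have "\<dots> \<le> card (shset F)"
  proof (rule card_mono[OF finite_shset[OF assms]])
    have "insert y S \<in> shset F" if "S \<in> ?A \<inter> ?B" for S
      by (cases b) (use that in \<open>auto intro: shset_insert\<close>)
    then show "?A \<union> ?B \<union> insert y ` (?A \<inter> ?B) \<subseteq> shset F"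
      by (blast dest: shset_side)
  qed
  finally show ?thesis .
qed

lemma side_both_nonempty:
  assumes "u \<in> F" "w \<in> F" "u \<noteq> w"
  obtains y where "\<And>b. side y b F \<noteq> {}"
proof -
  obtain y where "(y \<in> u) \<noteq> (y \<in> w)" using assms by blast
  then have "side y b F \<noteq> {}" for b
    using assms unfolding side_def by (cases "(y \<in> u) = b") auto
  then show thesis by (rule that)
qed

lemma card_side_less:
  assumes "finite F" "\<And>c. side y c F \<noteq> {}"
  shows "card (side y b F) < card F"
proof -
  have "card (side y (\<not> b) F) > 0"
    using assms finite_subset[OF side_subset] by (metis card_gt_0_iff)
  then show ?thesis using card_side[OF assms(1), of y b] by linarith
qed

text \<open>A label separating two members splits \<open>F\<close> into two smaller sides, whose
  bounds add up by \<open>card_shset_sides\<close>.\<close>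

lemma pajor: "finite (\<Union>F) \<Longrightarrow> card F \<le> card (shset F)"
proof (induction "card F" arbitrary: F rule: less_induct)
  case less
  note fin = finite_UnionD[OF less.prems]
  show ?case
  proof (cases "\<exists>u w. u \<in> F \<and> w \<in> F \<and> u \<noteq> w")
    case True
    then obtain y where y: "\<And>b. side y b F \<noteq> {}" by (metis side_both_nonempty)
    have "card (side y b F) \<le> card (shset (side y b F))" for b
      by (rule less.hyps)
        (use card_side_less[OF fin y] finite_Union_subset[OF less.prems side_subset] in auto)
    from this[of True] this[of False] show ?thesis
      using card_shset_sides[OF less.prems, of y True] card_side[OF fin, of y True] by simp
  next
    case False
    then consider "F = {}" | u where "F = {u}" by blast
    then show ?thesis
    proof cases
      case 2
      then have "{} \<in> shset F" by (simp add: in_shset_iff)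
      then have "card (shset F) > 0" using finite_shset[OF less.prems] by (auto simp: card_gt_0_iff)
      then show ?thesis using 2 by simp
    qed simp
  qed
qed

section \<open>Sides, boundaries and sections of extremal families\<close>

lemma finite_mem_shset:
  assumes "ext F" "S \<in> shset F"
  shows "finite S"
proof (rule finite_subset)
  show "S \<subseteq> \<Union>F" using assms(2) by (rule shset_subset)
  show "finite (\<Union>F)" using assms(1) by (simp add: ext_def)
qed

lemma ext_finite:
  assumes "ext F"
  shows "finite (\<Union>F)" "finite F"
  using assms finite_UnionD unfolding ext_def by blast+

text \<open>Pajor's bounds for the two sides already sum to \<open>card F\<close>, so equality for
  \<open>F\<close> forces equality in each.\<close>

lemma ext_side:
  assumes "ext F"
  shows "ext (side y b F)"
proof -
  note fin = ext_finite[OF assms]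
  have fs: "finite (\<Union>(side y c F))" for c by (rule finite_Union_subset[OF fin(1) side_subset])
  show ?thesis
    using card_shset_sides[OF fin(1), of y b] card_side[OF fin(2), of y b] fs
      pajor[OF fs[of b]] pajor[OF fs[of "\<not> b"]] assms unfolding ext_def by simp
qed

text \<open>The projection of \<open>F\<close> along \<open>y\<close> accounts for the shattered sets without \<open>y\<close>, the boundary
  for those with \<open>y\<close>; Pajor's inequality for both must then be tight.\<close>

lemma ext_bd:
  assumes "ext F"
  shows "ext (bd y b F)"
proof -
  note fin = ext_finite[OF assms]
  have fb: "finite (\<Union>(bd y b F))"
    by (rule finite_Union_subset[OF fin(1)]) (auto simp: bd_def side_def)
  let ?r = "\<lambda>G. G - {y}"
  have inj: "inj_on ?r (side y c F)" for c
  proof (rule inj_onI)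
    fix G G' assume "G \<in> side y c F" "G' \<in> side y c F" and eq: "G - {y} = G' - {y}"
    then have "(y \<in> G) = (y \<in> G')" by (simp add: side_def)
    then show "G = G'" using eq by (metis insert_Diff Diff_insert0 Diff_empty)
  qed
  \<comment> \<open>A common projection comes from two members that are flips of each other across
    \<open>y\<close>.\<close>
  have int: "?r ` side y True F \<inter> ?r ` side y False F = ?r ` bd y b F"
  proof (intro equalityI subsetI)
    fix A assume "A \<in> ?r ` side y True F \<inter> ?r ` side y False F"
    then obtain G G' where "G \<in> side y True F" "G' \<in> side y False F" "A = ?r G" "A = ?r G'"
      by blast
    then have G: "G \<in> F" "G' \<in> F" "y \<in> G" "y \<notin> G'" "A = ?r G" "A = G'"
      by (simp_all add: side_def)
    then have "flip y G = G'" "flip y G' = G" by (auto simp: flip_def)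
    then show "A \<in> ?r ` bd y b F"
      using G by (intro image_eqI[of _ _ "if b then G else G'"]) (auto simp: bd_def side_def)
  next
    fix A assume "A \<in> ?r ` bd y b F"
    then obtain G where "G \<in> bd y b F" and A: "A = ?r G" by blast
    then have G: "G \<in> F" "flip y G \<in> F" by (simp_all add: bd_def side_def)
    have A': "A = ?r (flip y G)" using A by (simp add: flip_def)
    have "A \<in> ?r ` side y c F" for c
    proof (cases "(y \<in> G) = c")
      case True then show ?thesis using G(1) A by (simp add: side_def)
    next
      case False then have "flip y G \<in> side y c F" using G(2) by (simp add: side_def)
      then show ?thesis using A' by blast
    qed
    then show "A \<in> ?r ` side y True F \<inter> ?r ` side y False F" by blast
  qed
  have un: "?r ` side y True F \<union> ?r ` side y False F = ?r ` F"
    using side_Un[of y True F] by (metis image_Un)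
  have inj_bd: "inj_on ?r (bd y b F)"
    by (rule inj_on_subset[OF inj[of b]]) (auto simp: bd_def)
  have count: "card F = card (?r ` F) + card (bd y b F)"
  proof -
    have fs: "finite (side y c F)" for c by (rule finite_subset[OF side_subset fin(2)])
    have "card F = card (?r ` side y True F) + card (?r ` side y False F)"
      using card_side[OF fin(2), of y True] by (simp add: card_image inj)
    also have "\<dots> = card (?r ` F) + card (?r ` bd y b F)"
      using card_Un_Int[OF finite_imageI[OF fs] finite_imageI[OF fs], of ?r True ?r False]
      by (simp only: un int)
    finally show ?thesis by (simp add: card_image inj_bd)
  qed
  have sub: "shset (?r ` F) \<subseteq> shset F" and ny: "\<And>S. S \<in> shset (?r ` F) \<Longrightarrow> y \<notin> S"
  proof -
    show nyS: "y \<notin> S" if "S \<in> shset (?r ` F)" for S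
      using shset_subset[OF that] by auto
    show "shset (?r ` F) \<subseteq> shset F"
    proof
      fix S assume S: "S \<in> shset (?r ` F)"
      then have "(G - {y}) \<inter> S = G \<inter> S" for G using nyS by blast
      then show "S \<in> shset F" using S unfolding in_shset_iff by simp
    qed
  qed
  have fr: "finite (\<Union>(?r ` F))" by (rule finite_subset[OF _ fin(1)]) auto
  have inji: "inj_on (insert y) (shset (bd y b F))"
    by (rule inj_onI) (metis insert_ident shset_bd_insert(2))
  have disj: "shset (?r ` F) \<inter> insert y ` shset (bd y b F) = {}" using ny by blast
  have "card (shset (?r ` F)) + card (shset (bd y b F))
      = card (shset (?r ` F) \<union> insert y ` shset (bd y b F))"
    using card_Un_disjoint[OF finite_shset[OF fr] finite_imageI[OF finite_shset[OF fb]] disj]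
    by (simp only: card_image[OF inji])
  also have "\<dots> \<le> card (shset F)"
    by (rule card_mono[OF finite_shset[OF fin(1)]]) (use sub shset_bd_insert(1) in auto)
  also have "\<dots> = card F" using assms by (simp add: ext_def)
  finally have "card (shset (bd y b F)) = card (bd y b F)"
    using count pajor[OF fr] pajor[OF fb] by linarith
  then show ?thesis using fb by (simp add: ext_def)
qed

text \<open>Prescribing the values on \<open>S\<close> one point at a time means taking sides
  repeatedly.\<close>

lemma ext_cube:
  assumes "ext F" "finite S"
  shows "ext {G \<in> F. \<forall>s\<in>S. (s \<in> G) = (s \<in> u)}"
  using assms(2)
proof induction
  case empty
  then show ?case using assms(1) by simp
next
  case (insert s S)
  have "{G \<in> F. \<forall>t\<in>insert s S. (t \<in> G) = (t \<in> u)}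
      = side s (s \<in> u) {G \<in> F. \<forall>t\<in>S. (t \<in> G) = (t \<in> u)}"
    by (auto simp: side_def)
  then show ?case using ext_side[OF insert.IH] by simp
qed

text \<open>If \<open>w\<close> is a member closest to \<open>u\<close>, then the section of \<open>F\<close> that agrees with \<open>u\<close> wherever \<open>w\<close> does
  is \<open>{u, w}\<close>. It is extremal, hence shatters only two sets, so \<open>w\<close> differs from \<open>u\<close> in one point.\<close>

lemma ext_neighbour:
  assumes "ext F" "u \<in> F" "F \<noteq> {u}"
  obtains z where "flip z u \<in> F"
proof -
  \<comment> \<open>The symmetric difference with \<open>u\<close>; its size is the distance to be
    minimised.\<close>
  define sd where "sd w = (u - w) \<union> (w - u)" for w
  note fin = ext_finite(1)[OF assms(1)]
  have fsd: "finite (sd w)" if "w \<in> F" for w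
    by (rule finite_subset[OF _ fin]) (use that assms in \<open>auto simp: sd_def\<close>)
  obtain w' where "w' \<in> F \<and> w' \<noteq> u" using assms by blast
  then obtain w where w: "w \<in> F" "w \<noteq> u"
    and min: "\<And>G. G \<in> F \<Longrightarrow> G \<noteq> u \<Longrightarrow> card (sd w) \<le> card (sd G)"
    using ex_has_least_nat[of "\<lambda>w. w \<in> F \<and> w \<noteq> u" w' "\<lambda>w. card (sd w)"] by blast
  let ?Y = "{G \<in> F. \<forall>s\<in>\<Union>F - sd w. (s \<in> G) = (s \<in> u)}"
  have Y: "?Y = {u, w}"
  proof (intro equalityI subsetI)
    fix G assume G: "G \<in> ?Y"
    have "sd G \<subseteq> sd w" using G assms(2) by (auto simp: sd_def)
    then have "sd G = sd w" if "G \<noteq> u"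
      using min[of G] that G fsd[OF w(1)] by (intro card_seteq) auto
    moreover have "G = w" if "sd G = sd w"
      using that unfolding sd_def by blast
    ultimately show "G \<in> {u, w}" by blast
  qed (use assms w in \<open>auto simp: sd_def\<close>)
  have extY: "ext {u, w}" using ext_cube[OF assms(1), of "\<Union>F - sd w" u] fin Y by simp
  \<comment> \<open>Each point where \<open>u\<close> and \<open>w\<close> differ yields a shattered
    singleton, in addition to \<open>{}\<close>.\<close>
  have "insert {} ((\<lambda>d. {d}) ` sd w) \<subseteq> shset {u, w}"
  proof -
    have "{} \<in> shset {u, w}" by (auto simp: in_shset_iff)
    moreover have "{d} \<in> shset {u, w}" if "d \<in> sd w" for d
      using that unfolding in_shset_iff sd_def by (auto simp: subset_singleton_iff)
    ultimately show ?thesis by blast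
  qed
  moreover have "card (insert {} ((\<lambda>d. {d}) ` sd w)) = Suc (card (sd w))"
    using fsd[OF w(1)] by (subst card_insert_disjoint) (auto simp: card_image inj_on_def)
  ultimately have "Suc (card (sd w)) \<le> card (shset {u, w})"
    using card_mono finite_shset extY ext_def by metis
  then have "Suc (card (sd w)) \<le> 2" using extY w by (simp add: ext_def)
  moreover have "sd w \<noteq> {}" using w by (auto simp: sd_def)
  then have "card (sd w) > 0" using fsd[OF w(1)] by (simp add: card_gt_0_iff)
  ultimately have "card (sd w) = 1" by linarith
  then obtain z where z: "sd w = {z}" by (metis card_1_singletonE)
  then have "(x \<in> u) \<noteq> (x \<in> w) \<longleftrightarrow> x = z" for x unfolding sd_def by blast
  then have "flip z u = w" by (intro set_eqI) (metis flip_simps(2) flip_other)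
  then show thesis using w that by blast
qed

section \<open>Labels and leaves of trees\<close>

lemma singleton_shset:
  assumes "\<And>b. side y b F \<noteq> {}"
  shows "{y} \<in> shset F"
proof -
  have "{} \<in> shset (side y b F)" for b using assms[of b] by (auto simp: in_shset_iff)
  then show ?thesis using shset_insert[of "{}" y F] by simp
qed

text \<open>An extremal family of dimension 1 is a tree whose edges carry pairwise distinct labels; the smallest
  side of an edge that avoids \<open>v\<close> is a leaf.\<close>

lemma exists_leaf:
  assumes ext: "ext T" and dim: "\<forall>S \<in> shset T. card S \<le> 1"
    and v: "v \<in> T" "T \<noteq> {v}"
  obtains y l where "l \<noteq> v" "side y (y \<in> l) T = {l}" "\<And>b. side y b T \<noteq> {}"
proof -
  note fin = ext_finite(2)[OF ext]
  obtain w where w: "w \<in> T" "w \<noteq> v" using v by blast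
  obtain y0 where y0: "\<forall>b. side y0 b T \<noteq> {}" using side_both_nonempty[OF w(1) v(1) w(2)] by metis
  obtain y where y: "\<forall>b. side y b T \<noteq> {}"
    and min: "\<And>z. (\<forall>b. side z b T \<noteq> {}) \<Longrightarrow> card (side y (y \<notin> v) T) \<le> card (side z (z \<notin> v) T)"
    using ex_has_least_nat[of "\<lambda>y. \<forall>b. side y b T \<noteq> {}" y0 "\<lambda>y. card (side y (y \<notin> v) T)"] y0
    by blast
  obtain l where l: "l \<in> side y (y \<notin> v) T" using y by blast
  have ly: "(y \<in> l) = (y \<notin> v)" using l by (simp add: side_def)
  have "side y (y \<notin> v) T = {l}"
  proof (rule ccontr)
    assume "side y (y \<notin> v) T \<noteq> {l}"
    then obtain l' where l': "l' \<in> side y (y \<notin> v) T" "l' \<noteq> l" using l by blast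
    \<comment> \<open>A second label \<open>z\<close> inside the minimal side will cut off a still
      smaller side away from \<open>v\<close>.\<close>
    obtain z where z: "\<And>b. side z b (side y (y \<notin> v) T) \<noteq> {}"
      using side_both_nonempty[OF l'(1) l l'(2)] by metis
    have zy: "z \<noteq> y" using z[of True] z[of False] by (auto simp: side_def)
    have zT: "\<forall>b. side z b T \<noteq> {}" using z by (auto simp: side_def)
    \<comment> \<open>If \<open>z\<close> varied on both sides of \<open>y\<close>, both would
      shatter \<open>{z}\<close>, and \<open>T\<close> would shatter a pair.\<close>
    have const: "side z (z \<notin> v) (side y (y \<in> v) T) = {} \<or> side z (z \<in> v) (side y (y \<in> v) T) = {}"
    proof (rule ccontr)
      assume "\<not> ?thesis"
      then have "side z b (side y (y \<in> v) T) \<noteq> {}" for b by (cases b; cases "z \<in> v") auto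
      then have "{z} \<in> shset (side y (y \<in> v) T)" by (rule singleton_shset)
      moreover have "{z} \<in> shset (side y (y \<notin> v) T)" using z by (rule singleton_shset)
      ultimately have "{z} \<in> shset (side y c T)" for c by (cases "c = (y \<in> v)") simp_all
      then have "insert y {z} \<in> shset T" by (simp add: shset_insert)
      then show False using dim zy by (auto dest: bspec)
    qed
    have "v \<in> side z (z \<in> v) (side y (y \<in> v) T)" using v by (simp add: side_def)
    then have none: "side z (z \<notin> v) (side y (y \<in> v) T) = {}" using const by blast
    obtain G where G: "G \<in> side z (z \<in> v) (side y (y \<notin> v) T)" using z by blast
    have "side z (z \<notin> v) T \<subset> side y (y \<notin> v) T"
    proof (rule psubsetI)
      show "side z (z \<notin> v) T \<subseteq> side y (y \<notin> v) T" using none by (auto simp: side_def)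
      have "G \<in> side y (y \<notin> v) T" using G by (rule side_memD)
      moreover have "G \<notin> side z (z \<notin> v) T" using G by (simp add: side_def)
      ultimately show "side z (z \<notin> v) T \<noteq> side y (y \<notin> v) T" by metis
    qed
    then have "card (side z (z \<notin> v) T) < card (side y (y \<notin> v) T)"
      by (rule psubset_card_mono[OF finite_subset[OF side_subset fin]])
    then show False using min[OF zT] by simp
  qed
  then have "side y (y \<in> l) T = {l}" by (simp only: ly)
  moreover have "l \<noteq> v" using ly by metis
  ultimately show thesis using that y by metis
qed

section \<open>Corners and how they lift from sides\<close>

inductive corner :: "'a set set \<Rightarrow> 'a set \<Rightarrow> bool" for F u where
  cornerI: "u \<in> F \<Longrightarrow> S \<in> shset F \<Longrightarrow> (\<And>G. G \<in> F \<Longrightarrow> G \<inter> S = u \<inter> S \<Longrightarrow> G = u) \<Longrightarrow> corner F u"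

lemma corner_singleton: "corner {w} w"
  by (rule cornerI[of _ _ "{}"]) (simp_all add: in_shset_iff)

text \<open>The witness is \<open>{y}\<close>: the leaf is alone on its side of
  \<open>y\<close>.\<close>

lemma leaf_corner:
  assumes "side y (y \<in> l) F = {l}" "\<And>b. side y b F \<noteq> {}"
  shows "corner F l"
proof -
  have "G = l" if "G \<in> F" "G \<inter> {y} = l \<inter> {y}" for G
  proof -
    have "G \<in> side y (y \<in> l) F" using that by (auto simp: side_def)
    then show ?thesis using assms(1) by simp
  qed
  moreover have "l \<in> F" using assms(1) by (metis insertI1 side_memD)
  ultimately show ?thesis by (intro cornerI[OF _ singleton_shset[OF assms(2)]])
qed

text \<open>Adding \<open>y\<close> to the witness confines competitors to the side of
  \<open>u\<close>, which here equals the boundary.\<close>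

lemma corner_bd:
  assumes "corner (bd y b F) u" "side y b F = bd y b F"
  shows "corner F u"
proof -
  obtain S where u: "u \<in> bd y b F" and S: "S \<in> shset (bd y b F)"
    and uniq: "\<And>G. G \<in> bd y b F \<Longrightarrow> G \<inter> S = u \<inter> S \<Longrightarrow> G = u"
    by (rule corner.cases[OF assms(1)]) blast
  show ?thesis
  proof (rule cornerI[OF _ shset_bd_insert(1)[OF S]])
    show "u \<in> F" using u by (simp add: bd_def side_def)
    fix G assume G: "G \<in> F" "G \<inter> insert y S = u \<inter> insert y S"
    show "G = u"
    proof (rule uniq)
      have "y \<in> G \<longleftrightarrow> y \<in> u" using G(2) by blast
      then have "G \<in> side y b F" using G(1) u by (simp add: bd_def side_def)
      then show "G \<in> bd y b F" using assms(2) by simp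
      show "G \<inter> S = u \<inter> S" using G(2) by blast
    qed
  qed
qed

text \<open>Another member of \<open>F\<close> with the trace of \<open>u\<close> on \<open>S\<close> would give \<open>u\<close> a neighbour
  with that trace, necessarily across \<open>y\<close>.\<close>

lemma corner_side:
  assumes "ext F" "corner (side y b F) u" "u \<notin> bd y b F"
  shows "corner F u"
proof -
  obtain S where u: "u \<in> side y b F" and S: "S \<in> shset (side y b F)"
    and uniq: "\<And>G. G \<in> side y b F \<Longrightarrow> G \<inter> S = u \<inter> S \<Longrightarrow> G = u"
    by (rule corner.cases[OF assms(2)]) blast
  have SF: "S \<in> shset F" using S by (rule shset_side)
  have finS: "finite S"
    by (rule finite_mem_shset[OF assms(1) SF])
  have uF: "u \<in> F" using u by (rule side_memD)
  let ?X = "{G \<in> F. \<forall>s\<in>S. (s \<in> G) = (s \<in> u)}"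
  have "?X = {u}"
  proof (rule ccontr)
    assume "?X \<noteq> {u}"
    then obtain z where z: "flip z u \<in> ?X"
      using ext_neighbour[OF ext_cube[OF assms(1) finS, of u], of u] uF by blast
    show False
    proof (cases "z = y")
      case True
      then show False using z u assms(3) by (auto simp: bd_def)
    next
      case False
      then have "flip z u \<in> side y b F" using z u flip_other[of y z u] by (auto simp: side_def)
      then have "flip z u = u" using z by (intro uniq) auto
      then show False using flip_neq[of z u] by simp
    qed
  qed
  then show ?thesis by (intro cornerI[OF uF SF]) blast
qed

text \<open>The induction on \<open>card H\<close> covers all \<open>T\<close> at once, since the
  recursion replaces \<open>T\<close> by a boundary or by a side of \<open>T\<close>.\<close>

lemma corner_off_tree:
  assumes "ext H" "\<forall>S \<in> shset H. card S \<le> 2"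
    and "T \<subseteq> H" "ext T" "\<forall>S \<in> shset T. card S \<le> 1" "H \<noteq> T"
  shows "\<exists>u \<in> H - T. corner H u"
  using assms
proof (induction "card H" arbitrary: H T rule: less_induct)
  case less
  note extH = less.prems(1) and dimH = less.prems(2) and TH = less.prems(3)
    and extT = less.prems(4) and dimT = less.prems(5) and neq = less.prems(6)
  note fin = ext_finite(2)[OF extH]
  have dim_side: "\<forall>S \<in> shset (side y b H). card S \<le> 2" for y b
    using dimH by (auto dest: shset_side)
  \<comment> \<open>A set shattered by the boundary gains the point \<open>y\<close> in
    \<open>H\<close>, where the bound is 2.\<close>
  have dim_bd: "\<forall>S \<in> shset (bd y b H). card S \<le> 1" for y b
  proof
    fix S assume S: "S \<in> shset (bd y b H)"
    have i: "insert y S \<in> shset H" "y \<notin> S" using shset_bd_insert[OF S] by auto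
    have "finite S" using finite_mem_shset[OF extH i(1)] by simp
    then show "card S \<le> 1" using bspec[OF dimH i(1)] i(2) by simp
  qed
  \<comment> \<open>\<open>V\<close> contains every member of \<open>T\<close> on the chosen side:
    none if \<open>T\<close> misses it, at most the leaf \<open>v\<close> otherwise.\<close>
  have step: "\<exists>u \<in> H - T. corner H u"
    if y: "\<And>c. side y c H \<noteq> {}" and T: "T \<inter> side y b H \<subseteq> V"
      and V: "V = {} \<or> V = {v} \<and> v \<in> bd y b H" "side y b H \<noteq> V" for y b V v
  proof (cases "side y b H = bd y b H")
    case False
    \<comment> \<open>The boundary becomes the new tree. Since \<open>V\<close> lies in the
      boundary, a corner off the boundary also avoids \<open>T\<close>.\<close>
    have "\<exists>u \<in> side y b H - bd y b H. corner (side y b H) u"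
    proof (rule less.hyps)
      show "bd y b H \<subseteq> side y b H" by (simp add: bd_def subset_iff)
    qed (fact False card_side_less[OF fin y] ext_side[OF extH] ext_bd[OF extH] dim_side dim_bd)+
    then obtain u where u: "u \<in> side y b H" "u \<notin> bd y b H" "corner (side y b H) u" by blast
    then show ?thesis
      using corner_side[OF extH u(3,2)] T V(1) u(1,2) side_memD[OF u(1)] by blast
  next
    case True
    have "\<exists>u \<in> bd y b H - V. corner (bd y b H) u"
    proof (cases "\<exists>w. bd y b H = {w}")
      case True
      then obtain w where w: "bd y b H = {w}" by blast
      then show ?thesis using corner_singleton[of w] V \<open>side y b H = bd y b H\<close> by auto
    next
      case False
      \<comment> \<open>\<open>w\<close> is the vertex to avoid: \<open>v\<close> if
        \<open>V\<close> is \<open>{v}\<close>, otherwise arbitrary.\<close>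
      obtain w where w: "w \<in> bd y b H" "V \<subseteq> {w}" using y[of b] True V by auto
      have ne: "bd y b H \<noteq> {w}" using False by blast
      obtain z l where l: "l \<noteq> w" "side z (z \<in> l) (bd y b H) = {l}"
          "\<And>c. side z c (bd y b H) \<noteq> {}"
        by (rule exists_leaf[OF ext_bd[OF extH] dim_bd w(1) ne]) blast
      have "corner (bd y b H) l" by (rule leaf_corner[OF l(2,3)])
      moreover from this have "l \<in> bd y b H" by (rule corner.cases)
      ultimately show ?thesis using l(1) w(2) by blast
    qed
    then obtain u where u: "u \<in> bd y b H" "u \<notin> V" "corner (bd y b H) u" by blast
    then show ?thesis
      using corner_bd[OF u(3) True] T True u(1,2) side_memD[of u y b H] by blast
  qed
  show ?case
  proof (cases "\<exists>w. H = {w}")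
    case True
    then obtain w where w: "H = {w}" by blast
    then show ?thesis using corner_singleton[of w] TH neq by auto
  next
    case single: False
    show ?thesis
    proof (cases "\<exists>y b. (\<forall>c. side y c H \<noteq> {}) \<and> T \<inter> side y b H = {}")
      case True
      then obtain y b where "\<And>c. side y c H \<noteq> {}" "T \<inter> side y b H = {}" by blast
      then show ?thesis using step[of y b "{}"] by blast
    next
      case False
      have "H \<noteq> {}" using neq TH by auto
      then obtain a where a: "a \<in> H" by auto
      moreover have "H \<noteq> {a}" using single by auto
      ultimately obtain a' where "a' \<in> H" "a \<noteq> a'" by auto
      note a this
      then obtain x where x: "\<And>c. side x c H \<noteq> {}" by (metis side_both_nonempty)
      have ne: "T \<inter> side x c H \<noteq> {}" for c using False x by blast
      obtain p q where pq: "p \<in> T \<inter> side x True H" "q \<in> T \<inter> side x False H" using ne by blast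
      then have p: "p \<in> T" "T \<noteq> {p}" by (auto simp: side_def)
      obtain y v where yv: "side y (y \<in> v) T = {v}" and yT: "\<And>c. side y c T \<noteq> {}"
        by (rule exists_leaf[OF extT dimT p]) blast
      have yH: "side y c H \<noteq> {}" for c using yT[of c] TH by (auto simp: side_def)
      have vT: "v \<in> T" using yv by (metis insertI1 side_memD)
      have "T \<noteq> {v}" using yT[of True] yT[of False] by (auto simp: side_def)
      then obtain z where z: "flip z v \<in> T" by (rule ext_neighbour[OF extT vT])
      \<comment> \<open>A neighbour across any other label would share the side of \<open>y\<close>
        on which \<open>v\<close> is alone.\<close>
      have "z = y"
      proof (rule ccontr)
        assume "z \<noteq> y"
        then have "flip z v \<in> side y (y \<in> v) T" using z flip_other[of y z v] by (auto simp: side_def)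
        then show False using yv flip_neq by (metis singletonD)
      qed
      then have fv: "flip y v \<in> T" using z by simp
      have TH1: "T \<inter> side y (y \<in> v) H \<subseteq> {v}" using yv TH by (auto simp: side_def)
      show ?thesis
      proof (cases "side y (y \<in> v) H = {v}")
        case False
        have "v \<in> bd y (y \<in> v) H" using vT fv TH by (auto simp: bd_def side_def)
        then show ?thesis using step[OF yH TH1] False by blast
      next
        case True
        \<comment> \<open>Here \<open>v\<close> is alone on its side in both \<open>H\<close> and
          \<open>T\<close>, so it is removed from both.\<close>
        let ?H0 = "side y (y \<notin> v) H" and ?T0 = "side y (y \<notin> v) T"
        have H: "H = insert v ?H0" using True side_Un[of y "y \<in> v" H] by simp
        have T: "T = insert v ?T0" using yv side_Un[of y "y \<in> v" T] by simp
        have "\<exists>u \<in> ?H0 - ?T0. corner ?H0 u"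
        proof (rule less.hyps)
          show "card ?H0 < card H" using card_side_less[OF fin yH] .
          show "?H0 \<noteq> ?T0" using H T neq by metis
          show "?T0 \<subseteq> ?H0" using TH by (auto simp: side_def)
          show "\<forall>S \<in> shset ?T0. card S \<le> 1"
            using dimT by (auto dest: shset_side)
        qed (intro ext_side extH extT dim_side)+
        then obtain u where u: "u \<in> ?H0" "u \<notin> ?T0" and cu: "corner ?H0 u" by blast
        obtain S where S: "S \<in> shset ?H0"
          and uniq: "\<And>G. G \<in> ?H0 \<Longrightarrow> G \<inter> S = u \<inter> S \<Longrightarrow> G = u"
          by (rule corner.cases[OF cu]) blast
        have fvT: "flip y v \<in> ?T0" using fv by (simp add: side_def)
        then have fvH: "flip y v \<in> ?H0" using TH by (auto simp: side_def)
        \<comment> \<open>As \<open>y\<close> is not in \<open>S\<close>, \<open>v\<close> has the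
          trace of \<open>flip y v\<close>. That set lies in \<open>?T0\<close> and \<open>u\<close>
          does not, so the restored \<open>v\<close> cannot compete with \<open>u\<close>.\<close>
        have "v \<inter> S \<noteq> u \<inter> S"
          using uniq[OF fvH] flip_Int[OF notin_shset_side[OF S], of v] fvT u by auto
        then have uniqH: "G = u" if "G \<in> H" "G \<inter> S = u \<inter> S" for G
          using uniq[of G] that H by blast
        have uH: "u \<in> H" "u \<notin> T" using u by (simp_all add: side_def)
        have "corner H u" by (rule cornerI[OF uH(1) shset_side[OF S] uniqH])
        then show ?thesis using uH by blast
      qed
    qed
  qed
qed

text \<open>The witness \<open>S\<close> is no longer shattered, and Pajor's inequality prevents any
  further loss.\<close>

lemma ext_remove_corner:
  assumes "ext F" "corner F u"
  shows "ext (F - {u})"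
proof -
  note fin = ext_finite[OF assms(1)]
  have fin': "finite (\<Union>(F - {u}))" by (rule finite_Union_subset[OF fin(1)]) auto
  obtain S where u: "u \<in> F" and S: "S \<in> shset F"
    and uniq: "\<And>G. G \<in> F \<Longrightarrow> G \<inter> S = u \<inter> S \<Longrightarrow> G = u"
    by (rule corner.cases[OF assms(2)]) blast
  have "S \<notin> shset (F - {u})"
  proof
    assume "S \<in> shset (F - {u})"
    then obtain G where "G \<in> F - {u}" "G \<inter> S = u \<inter> S"
      unfolding in_shset_iff by (metis Int_lower2)
    then show False using uniq by blast
  qed
  then have "shset (F - {u}) \<subseteq> shset F - {S}" using shset_mono[of "F - {u}" F] by blast
  then have "card (shset (F - {u})) \<le> card (shset F) - 1"
    using card_mono[of "shset F - {S}"] finite_shset[OF fin(1)] S by fastforce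
  then show ?thesis
    using pajor[OF fin'] fin' card_Diff_singleton[OF u] assms(1) by (simp add: ext_def)
qed

section \<open>Transfer to the ground set \<open>{1..n}\<close>\<close>

lemma Sh_eq_shset:
  assumes "F \<subseteq> Pow {1..n}"
  shows "Sh n F = shset F"
proof -
  have "S \<subseteq> {1..n}" if "S \<in> shset F" for S
    using subset_trans[OF shset_subset[OF that], of "{1..n}"] assms by auto
  then show ?thesis by (auto simp: Sh_def shset_def)
qed

lemma extremal_iff_ext:
  assumes "F \<subseteq> Pow {1..n}"
  shows "extremal n F \<longleftrightarrow> ext F"
proof -
  have "\<Union>F \<subseteq> {1..n}" using assms by blast
  then have "finite (\<Union>F)" by (rule finite_subset) simp
  then show ?thesis by (simp add: extremal_def ext_def Sh_eq_shset[OF assms])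
qed

theorem theorem4p2:
  fixes n :: nat and \<F> :: "nat set set"
  assumes "n > 0"
    and "\<F> \<subseteq> Pow {1..n}"
    and "\<F> \<noteq> {}"
    and "extremal n \<F>"
    and "dim_VC n \<F> \<le> 2"
  shows "\<exists>F\<in>\<F>. extremal n (\<F> - {F})"
proof -
  have ext: "ext \<F>" using assms(4) extremal_iff_ext[OF assms(2)] by simp
  have dim: "\<forall>S \<in> shset \<F>. card S \<le> 2"
  proof
    fix S assume S: "S \<in> shset \<F>"
    have "finite (shset \<F>)" using ext finite_shset by (auto simp: ext_def)
    then have "card S \<le> Max (card ` shset \<F>)" using S by simp
    then show "card S \<le> 2" using assms(5) by (simp add: dim_VC_def Sh_eq_shset[OF assms(2)])
  qed
  have no_sh: "shset {} = {}" by (auto simp: in_shset_iff)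
  \<comment> \<open>The empty family serves as the tree: it shatters nothing, so it is extremal and
    its dimension bound is vacuous.\<close>
  have "\<exists>F \<in> \<F> - {}. corner \<F> F"
    by (rule corner_off_tree[OF ext dim]) (use assms(3) in \<open>auto simp: ext_def no_sh\<close>)
  then obtain F where F: "F \<in> \<F>" "corner \<F> F" by blast
  have "\<F> - {F} \<subseteq> Pow {1..n}" using assms(2) by blast
  then have "extremal n (\<F> - {F})"
    using ext_remove_corner[OF ext F(2)] by (simp add: extremal_iff_ext)
  then show ?thesis using F(1) by blast
qed

end
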